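(* Let $\mathcal{I}$ be an ideal of subsets of $\mathbb{R}$. Then $\mathcal{M}^{\mathcal{I}}$ is a monotone, convex generalized mean. If $\mathcal{I}$ is shift invariant, symmetric and homogeneous, then the mean $\mathcal{M}^{\mathcal{I}}$ has all these properties (shift invariant, symmetric, homogeneous) as well. If every finite subset of $\mathbb{R}$ belongs to $\mathcal{I}$, then $\mathcal{M}^{\mathcal{I}}$ is finite-independent and strongly internal.
   Context: An ideal is a nonempty family $\mathcal{I}\subset P(\mathbb{R})$ such that $A,B\in\mathcal{I}$ implies $A\cup B\in\mathcal{I}$, and $B\in\mathcal{I}$, $A\subset B$ implies $A\in\mathcal{I}$. The ideal $\mathcal{I}$ is: shift invariant if $H\in\mathcal{I}$, $x\in\mathbb{R}$ implies $H+x\in\mathcal{I}$; symmetric if $H\in\mathcal{I}$, $x\in\mathbb{R}$ implies $\{x+y:x-y\in H\}\in\mathcal{I}$; homogeneous if $H\in\mathcal{I}$, $\alpha\in\mathbb{R}$ implies $\alpha H\in\mathcal{I}$. Here $H+x=\{h+x:h\in H\}$, $\alpha H=\{\alpha h:h\in H\}$. For $H\subset\mathbb{R}$, $y\in\mathbb{R}$: $H^{y-}=H\cap(-\infty,y]$, $H^{y+}=H\cap[y,+\infty)$. For bounded $H\subset\mathbb{R}$, $H\notin\mathcal{I}$, set $\varlimsup^{\mathcal{I}}H=\inf\{x:H^{x+}\in\mathcal{I}\}$, $\varliminf^{\mathcal{I}}H=\sup\{x:H^{x-}\in\mathcal{I}\}$ and $\mathcal{M}^{\mathcal{I}}(H)=\frac{\varliminf^{\mathcal{I}}H+\varlimsup^{\mathcal{I}}H}{2}$.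 $Dom(\mathcal{M}^{\mathcal{I}})$ is the set of bounded $H\subset\mathbb{R}$ with $H\notin\mathcal{I}$. A generalized mean is a function $\mathcal{K}:Dom(\mathcal{K})\to\mathbb{R}$, where $Dom(\mathcal{K})$ consists of some bounded subsets of $\mathbb{R}$, with $\inf H\le\mathcal{K}(H)\le\sup H$ for all $H\in Dom(\mathcal{K})$. For infinite bounded $H$, $\varliminf H=\inf H'$ and $\varlimsup H=\sup H'$, where $H'$ is the set of accumulation points of $H$; $A-B$ is set difference. Properties of a mean $\mathcal{K}$: - strongly internal: $\varliminf H\le\mathcal{K}(H)\le\varlimsup H$ for all infinite $H\in Dom(\mathcal{K})$; - finite-independent: if $H\in Dom(\mathcal{K})$ is infinite and $V$ is finite then $H\cup V,\ H-V\in Dom(\mathcal{K})$ and $\mathcal{K}(H)=\mathcal{K}(H\cup V)=\mathcal{K}(H-V)$; - monotone: $\sup H_1\le\inf H_2$ implies $\mathcal{K}(H_1)\le\mathcal{K}(H_1\cup H_2)\le\mathcal{K}(H_2)$ (for $H_1,H_2,H_1\cup H_2\in Dom(\mathcal{K})$); - convex: if $I$ is a closed interval, $\mathcal{K}(H)\in I$, $L\subset I$, and $H,H\cup L\in Dom(\mathcal{K})$, then $\mathcal{K}(H\cup L)\in I$; - shift invariant: if $x\in\mathbb{R}$, $H\in Dom(\mathcal{K})$ then $H+x\in Dom(\mathcal{K})$ and $\mathcal{K}(H+x)=\mathcal{K}(H)+x$; - symmetric: if $H\in Dom(\mathcal{K})$ and $s\in\mathbb{R}$ is such that for all $x$, $s+x\in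 H\Leftrightarrow s-x\in H$, then $\mathcal{K}(H)=s$; - homogeneous: if $H\in Dom(\mathcal{K})$ and $\alpha\in\mathbb{R}$, $\alpha\ne 0$, then $\alpha H\in Dom(\mathcal{K})$ and $\mathcal{K}(\alpha H)=\alpha\mathcal{K}(H)$. *)

theory Defs
  imports "HOL-Analysis.Analysis"
begin

section \<open>Ideals of sets of reals\<close>

definition set_ideal :: "real set set \<Rightarrow> bool" where
  "set_ideal \<I> \<longleftrightarrow> \<I> \<noteq> {} \<and> (\<forall>A\<in>\<I>. \<forall>B\<in>\<I>. A \<union> B \<in> \<I>) \<and> (\<forall>B\<in>\<I>. \<forall>A. A \<subseteq> B \<longrightarrow> A \<in> \<I>)"

definition shift_invariant_ideal :: "real set set \<Rightarrow> bool" where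
  "shift_invariant_ideal \<I> \<longleftrightarrow> (\<forall>H\<in>\<I>. \<forall>x. (\<lambda>h. h + x) ` H \<in> \<I>)"

definition symmetric_ideal :: "real set set \<Rightarrow> bool" where
  "symmetric_ideal \<I> \<longleftrightarrow> (\<forall>H\<in>\<I>. \<forall>x. {x + y | y. x - y \<in> H} \<in> \<I>)"

definition homogeneous_ideal :: "real set set \<Rightarrow> bool" where
  "homogeneous_ideal \<I> \<longleftrightarrow> (\<forall>H\<in>\<I>. \<forall>\<alpha>. (\<lambda>h. \<alpha> * h) ` H \<in> \<I>)"

section \<open>Generalized means\<close>

text \<open>A mean is given by its domain \<open>D\<close> together with a function \<open>K\<close> whose values outside
  \<open>D\<close> are irrelevant. With the usual conventions for the infimum and supremum of the empty set
  (plus and minus infinity), the empty set cannot lie in the domain of a mean; since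
  \<open>Inf {}\<close> and \<open>Sup {}\<close> are unspecified reals here, this is required explicitly.\<close>

definition generalized_mean :: "real set set \<Rightarrow> (real set \<Rightarrow> real) \<Rightarrow> bool" where
  "generalized_mean D K \<longleftrightarrow> (\<forall>H\<in>D. bounded H \<and> H \<noteq> {} \<and> Inf H \<le> K H \<and> K H \<le> Sup H)"

definition lower_acc :: "real set \<Rightarrow> real" where
  "lower_acc H = Inf {x. x islimpt H}"

definition upper_acc :: "real set \<Rightarrow> real" where
  "upper_acc H = Sup {x. x islimpt H}"

definition strongly_internal :: "real set set \<Rightarrow> (real set \<Rightarrow> real) \<Rightarrow> bool" where
  "strongly_internal D K \<longleftrightarrow>
    (\<forall>H\<in>D. infinite H \<longrightarrow> lower_acc H \<le> K H \<and> K H \<le> upper_acc H)"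

definition finite_independent :: "real set set \<Rightarrow> (real set \<Rightarrow> real) \<Rightarrow> bool" where
  "finite_independent D K \<longleftrightarrow>
    (\<forall>H\<in>D. \<forall>V. infinite H \<and> finite V \<longrightarrow>
      H \<union> V \<in> D \<and> H - V \<in> D \<and> K H = K (H \<union> V) \<and> K H = K (H - V))"

definition monotone_mean :: "real set set \<Rightarrow> (real set \<Rightarrow> real) \<Rightarrow> bool" where
  "monotone_mean D K \<longleftrightarrow>
    (\<forall>H1\<in>D. \<forall>H2\<in>D. H1 \<union> H2 \<in> D \<and> Sup H1 \<le> Inf H2 \<longrightarrow>
      K H1 \<le> K (H1 \<union> H2) \<and> K (H1 \<union> H2) \<le> K H2)"

text \<open>Closed intervals may be unbounded here; as the sets in the domain are bounded, this is no
  more demanding than considering only the intervals \<open>{a..b}\<close>.\<close>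

definition convex_mean :: "real set set \<Rightarrow> (real set \<Rightarrow> real) \<Rightarrow> bool" where
  "convex_mean D K \<longleftrightarrow>
    (\<forall>J H L. is_interval J \<and> closed J \<and> K H \<in> J \<and> L \<subseteq> J \<and> H \<in> D \<and> H \<union> L \<in> D \<longrightarrow>
      K (H \<union> L) \<in> J)"

definition shift_invariant_mean :: "real set set \<Rightarrow> (real set \<Rightarrow> real) \<Rightarrow> bool" where
  "shift_invariant_mean D K \<longleftrightarrow>
    (\<forall>H\<in>D. \<forall>x. (\<lambda>h. h + x) ` H \<in> D \<and> K ((\<lambda>h. h + x) ` H) = K H + x)"

definition symmetric_mean :: "real set set \<Rightarrow> (real set \<Rightarrow> real) \<Rightarrow> bool" where
  "symmetric_mean D K \<longleftrightarrow>
    (\<forall>H\<in>D. \<forall>s. (\<forall>x. s + x \<in> H \<longleftrightarrow> s - x \<in> H) \<longrightarrow> K H = s)"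

definition homogeneous_mean :: "real set set \<Rightarrow> (real set \<Rightarrow> real) \<Rightarrow> bool" where
  "homogeneous_mean D K \<longleftrightarrow>
    (\<forall>H\<in>D. \<forall>\<alpha>. \<alpha> \<noteq> 0 \<longrightarrow> (\<lambda>h. \<alpha> * h) ` H \<in> D \<and> K ((\<lambda>h. \<alpha> * h) ` H) = \<alpha> * K H)"

section \<open>The mean associated with an ideal\<close>

text \<open>For an ideal \<open>\<I>\<close> and a bounded set \<open>H \<notin> \<I>\<close>, both sets of reals below are nonempty and
  bounded on the relevant side, so the real-valued \<open>Inf\<close> and \<open>Sup\<close> are the genuine ones.\<close>

definition ideal_limsup :: "real set set \<Rightarrow> real set \<Rightarrow> real" where
  "ideal_limsup \<I> H = Inf {x. H \<inter> {x..} \<in> \<I>}"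

definition ideal_liminf :: "real set set \<Rightarrow> real set \<Rightarrow> real" where
  "ideal_liminf \<I> H = Sup {x. H \<inter> {..x} \<in> \<I>}"

definition ideal_mean :: "real set set \<Rightarrow> real set \<Rightarrow> real" where
  "ideal_mean \<I> H = (ideal_liminf \<I> H + ideal_limsup \<I> H) / 2"

definition ideal_mean_dom :: "real set set \<Rightarrow> real set set" where
  "ideal_mean_dom \<I> = {H. bounded H \<and> H \<notin> \<I>}"

end

theory Submission
  imports Defs
begin

text \<open>For bounded \<open>H\<close> outside the ideal, let l and u be its lower and upper ideal
  limits. By heredity, the x whose lower section \<open>H \<inter> {..x}\<close> lies in the ideal
  form a down-set with supremum l, and dually for u; l \<le> u, since a point strictly between u and
  l would split \<open>H\<close> into two members of the ideal. Every property is then read off from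
  which sections are negligible.

  Enlarging a set lowers l and raises u. Adding points that are all \<ge> c leaves the sections
  below c unchanged, so l cannot drop below both c and its old value
  (\<open>ideal_liminf_Un_ge\<close>, dually \<open>ideal_limsup_Un_le\<close>). These facts give
  monotonicity and convexity.

  An affine bijection h -> a h + b preserves membership in a shift invariant, homogeneous ideal in
  both directions and carries sections to sections, swapping the two kinds if a < 0. The midpoint of
  l and u ignores the swap, so the mean commutes with the map (\<open>ideal_mean_affine\<close>).
  Shifts and scalings are special cases, and symmetry about s is invariance under h -> 2 s - h,
  which forces the mean m to satisfy m = 2 s - m.

  Changing a set by a member of the ideal changes no section's membership
  (\<open>ideal_mean_cong\<close>), which gives finite independence. By Bolzano-Weierstrass,
  sections strictly outside the range of accumulation points are finite, which gives strong
  internality.\<close>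

lemma set_ideal_subset: "set_ideal \<I> \<Longrightarrow> B \<in> \<I> \<Longrightarrow> A \<subseteq> B \<Longrightarrow> A \<in> \<I>"
  unfolding set_ideal_def by blast

lemma set_ideal_Un: "set_ideal \<I> \<Longrightarrow> A \<in> \<I> \<Longrightarrow> B \<in> \<I> \<Longrightarrow> A \<union> B \<in> \<I>"
  unfolding set_ideal_def by blast

lemma set_ideal_empty: "set_ideal \<I> \<Longrightarrow> {} \<in> \<I>"
  unfolding set_ideal_def by blast

lemma ideal_mean_dom_nonempty: "set_ideal \<I> \<Longrightarrow> H \<in> ideal_mean_dom \<I> \<Longrightarrow> H \<noteq> {}"
  using set_ideal_empty by (auto simp: ideal_mean_dom_def)

lemma ideal_mean_dom_bounds:
  assumes "H \<in> ideal_mean_dom \<I>"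
  shows "bdd_below H" "bdd_above H"
  using assms bounded_imp_bdd_below bounded_imp_bdd_above by (auto simp: ideal_mean_dom_def)

section \<open>Lower and upper limits as cuts of the line\<close>

text \<open>The defining set lies between the open and the closed half-line ending at
  \<open>a\<close>, so its supremum is \<open>a\<close> whether or not \<open>a\<close> belongs to
  it.\<close>

lemma ideal_liminf_eqI:
  assumes "\<And>x. x < a \<Longrightarrow> H \<inter> {..x} \<in> \<I>" and "\<And>x. a < x \<Longrightarrow> H \<inter> {..x} \<notin> \<I>"
  shows "ideal_liminf \<I> H = a"
  unfolding ideal_liminf_def
proof (rule cSup_eq)
  show "x \<le> a" if "x \<in> {x. H \<inter> {..x} \<in> \<I>}" for x
    using assms(2)[of x] that by force
  show "a \<le> y" if "\<And>x. x \<in> {x. H \<inter> {..x} \<in> \<I>} \<Longrightarrow> x \<le> y" for y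
    by (rule dense_le) (use assms(1) that in simp)
qed

lemma ideal_limsup_eqI:
  assumes "\<And>x. a < x \<Longrightarrow> H \<inter> {x..} \<in> \<I>" and "\<And>x. x < a \<Longrightarrow> H \<inter> {x..} \<notin> \<I>"
  shows "ideal_limsup \<I> H = a"
  unfolding ideal_limsup_def
proof (rule cInf_eq)
  show "a \<le> x" if "x \<in> {x. H \<inter> {x..} \<in> \<I>}" for x
    using assms(2)[of x] that by force
  show "y \<le> a" if "\<And>x. x \<in> {x. H \<inter> {x..} \<in> \<I>} \<Longrightarrow> y \<le> x" for y
    by (rule dense_ge) (use assms(1) that in simp)
qed

context
  fixes \<I> :: "real set set" and H :: "real set"
  assumes ideal: "set_ideal \<I>" and dom: "H \<in> ideal_mean_dom \<I>"
begin

text \<open>From \<open>Sup H\<close> on, the section is all of \<open>H\<close>, which is not in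
  the ideal. This bounds the set whose supremum is taken.\<close>

lemma liminf_section_less_Sup:
  assumes "H \<inter> {..x} \<in> \<I>"
  shows "x < Sup H"
proof (rule ccontr)
  assume "\<not> x < Sup H"
  then have "H \<inter> {..x} = H"
    using cSup_upper[OF _ ideal_mean_dom_bounds(2)[OF dom]] by force
  with assms dom show False by (simp add: ideal_mean_dom_def)
qed

lemma limsup_section_greater_Inf:
  assumes "H \<inter> {x..} \<in> \<I>"
  shows "Inf H < x"
proof (rule ccontr)
  assume "\<not> Inf H < x"
  then have "H \<inter> {x..} = H"
    using cInf_lower[OF _ ideal_mean_dom_bounds(1)[OF dom]] by force
  with assms dom show False by (simp add: ideal_mean_dom_def)
qed

lemma liminf_section_bdd: "bdd_above {x. H \<inter> {..x} \<in> \<I>}"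
  using liminf_section_less_Sup by (intro bdd_aboveI[of _ "Sup H"]) (simp add: less_imp_le)

lemma limsup_section_bdd: "bdd_below {x. H \<inter> {x..} \<in> \<I>}"
  using limsup_section_greater_Inf by (intro bdd_belowI[of _ "Inf H"]) (simp add: less_imp_le)

lemma section_below_Inf: "x < Inf H \<Longrightarrow> H \<inter> {..x} \<in> \<I>"
proof -
  assume "x < Inf H"
  then have "H \<inter> {..x} = {}"
    using cInf_lower[OF _ ideal_mean_dom_bounds(1)[OF dom]] by force
  then show ?thesis using set_ideal_empty[OF ideal] by simp
qed

lemma section_above_Sup: "Sup H < x \<Longrightarrow> H \<inter> {x..} \<in> \<I>"
proof -
  assume "Sup H < x"
  then have "H \<inter> {x..} = {}"
    using cSup_upper[OF _ ideal_mean_dom_bounds(2)[OF dom]] by force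
  then show ?thesis using set_ideal_empty[OF ideal] by simp
qed

lemma section_le_ideal_liminf: "H \<inter> {..x} \<in> \<I> \<Longrightarrow> x \<le> ideal_liminf \<I> H"
  unfolding ideal_liminf_def by (intro cSup_upper liminf_section_bdd) simp

lemma ideal_limsup_le_section: "H \<inter> {x..} \<in> \<I> \<Longrightarrow> ideal_limsup \<I> H \<le> x"
  unfolding ideal_limsup_def by (intro cInf_lower limsup_section_bdd) simp

text \<open>A section in the ideal reaches past \<open>x\<close>, and heredity passes membership
  down to \<open>x\<close>. The inequality is strict because the supremum need not be
  attained.\<close>

lemma section_less_ideal_liminf:
  assumes "x < ideal_liminf \<I> H"
  shows "H \<inter> {..x} \<in> \<I>"
proof -
  have "{x. H \<inter> {..x} \<in> \<I>} \<noteq> {}"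
    using section_below_Inf[of "Inf H - 1"] by auto
  then obtain y where "H \<inter> {..y} \<in> \<I>" "x < y"
    using assms unfolding ideal_liminf_def by (auto simp: less_cSup_iff liminf_section_bdd)
  then show ?thesis by (elim set_ideal_subset[OF ideal]) auto
qed

lemma section_greater_ideal_limsup:
  assumes "ideal_limsup \<I> H < x"
  shows "H \<inter> {x..} \<in> \<I>"
proof -
  have "{x. H \<inter> {x..} \<in> \<I>} \<noteq> {}"
    using section_above_Sup[of "Sup H + 1"] by auto
  then obtain y where "H \<inter> {y..} \<in> \<I>" "y < x"
    using assms unfolding ideal_limsup_def by (auto simp: cInf_less_iff limsup_section_bdd)
  then show ?thesis by (elim set_ideal_subset[OF ideal]) auto
qed

text \<open>Testing only \<open>x\<close> strictly below \<open>a\<close> suffices by density; this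
  avoids deciding the section at the cut itself.\<close>

lemma ideal_liminf_geI:
  assumes "\<And>x. x < a \<Longrightarrow> H \<inter> {..x} \<in> \<I>"
  shows "a \<le> ideal_liminf \<I> H"
  by (rule dense_le) (use assms section_le_ideal_liminf in blast)

lemma ideal_limsup_leI:
  assumes "\<And>x. a < x \<Longrightarrow> H \<inter> {x..} \<in> \<I>"
  shows "ideal_limsup \<I> H \<le> a"
  by (rule dense_ge) (use assms ideal_limsup_le_section in blast)

lemma Inf_le_ideal_liminf: "Inf H \<le> ideal_liminf \<I> H"
  by (intro ideal_liminf_geI section_below_Inf)

lemma ideal_limsup_le_Sup: "ideal_limsup \<I> H \<le> Sup H"
  by (intro ideal_limsup_leI section_above_Sup)

lemma ideal_liminf_le_limsup: "ideal_liminf \<I> H \<le> ideal_limsup \<I> H"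
proof (rule ccontr)
  assume "\<not> ?thesis"
  then obtain x where "ideal_limsup \<I> H < x" "x < ideal_liminf \<I> H"
    using dense[of "ideal_limsup \<I> H" "ideal_liminf \<I> H"] by auto
  then have "H \<inter> {x..} \<union> H \<inter> {..x} \<in> \<I>"
    by (intro set_ideal_Un[OF ideal] section_greater_ideal_limsup section_less_ideal_liminf)
  moreover have "H \<inter> {x..} \<union> H \<inter> {..x} = H" by auto
  ultimately show False using dom by (simp add: ideal_mean_dom_def)
qed

lemma ideal_mean_between:
  "ideal_liminf \<I> H \<le> ideal_mean \<I> H" "ideal_mean \<I> H \<le> ideal_limsup \<I> H"
  using ideal_liminf_le_limsup by (simp_all add: ideal_mean_def)

lemma Inf_le_ideal_mean: "Inf H \<le> ideal_mean \<I> H"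
  using Inf_le_ideal_liminf ideal_mean_between(1) by (rule order_trans)

lemma ideal_mean_le_Sup: "ideal_mean \<I> H \<le> Sup H"
  using ideal_mean_between(2) ideal_limsup_le_Sup by (rule order_trans)

end

section \<open>Limits of subsets and unions; monotonicity and convexity\<close>

lemma ideal_lim_subset:
  assumes ideal: "set_ideal \<I>" and A: "A \<in> ideal_mean_dom \<I>" and B: "B \<in> ideal_mean_dom \<I>"
    and "A \<subseteq> B"
  shows "ideal_liminf \<I> B \<le> ideal_liminf \<I> A" "ideal_limsup \<I> A \<le> ideal_limsup \<I> B"
proof -
  show "ideal_liminf \<I> B \<le> ideal_liminf \<I> A"
  proof (rule ideal_liminf_geI[OF ideal A])
    fix x assume "x < ideal_liminf \<I> B"
    from section_less_ideal_liminf[OF ideal B this] show "A \<inter> {..x} \<in> \<I>"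
      by (rule set_ideal_subset[OF ideal]) (use \<open>A \<subseteq> B\<close> in blast)
  qed
  show "ideal_limsup \<I> A \<le> ideal_limsup \<I> B"
  proof (rule ideal_limsup_leI[OF ideal A])
    fix x assume "ideal_limsup \<I> B < x"
    from section_greater_ideal_limsup[OF ideal B this] show "A \<inter> {x..} \<in> \<I>"
      by (rule set_ideal_subset[OF ideal]) (use \<open>A \<subseteq> B\<close> in blast)
  qed
qed

text \<open>Below \<open>c\<close> the set \<open>B\<close> contributes nothing, so \<open>A\<close>
  and \<open>A \<union> B\<close> have equal sections there. \<open>B\<close> itself may be
  negligible or empty, as convexity requires.\<close>

lemma ideal_liminf_Un_ge:
  assumes ideal: "set_ideal \<I>" and A: "A \<in> ideal_mean_dom \<I>" and AB: "A \<union> B \<in> ideal_mean_dom \<I>"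
    and B: "\<And>b. b \<in> B \<Longrightarrow> c \<le> b"
  shows "min c (ideal_liminf \<I> A) \<le> ideal_liminf \<I> (A \<union> B)"
proof (rule ideal_liminf_geI[OF ideal AB])
  fix x assume x: "x < min c (ideal_liminf \<I> A)"
  then have "(A \<union> B) \<inter> {..x} = A \<inter> {..x}" using B by force
  then show "(A \<union> B) \<inter> {..x} \<in> \<I>"
    using section_less_ideal_liminf[OF ideal A, of x] x by simp
qed

lemma ideal_limsup_Un_le:
  assumes ideal: "set_ideal \<I>" and A: "A \<in> ideal_mean_dom \<I>" and AB: "A \<union> B \<in> ideal_mean_dom \<I>"
    and B: "\<And>b. b \<in> B \<Longrightarrow> b \<le> c"
  shows "ideal_limsup \<I> (A \<union> B) \<le> max c (ideal_limsup \<I> A)"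
proof (rule ideal_limsup_leI[OF ideal AB])
  fix x assume x: "max c (ideal_limsup \<I> A) < x"
  then have "(A \<union> B) \<inter> {x..} = A \<inter> {x..}" using B by force
  then show "(A \<union> B) \<inter> {x..} \<in> \<I>"
    using section_greater_ideal_limsup[OF ideal A, of x] x by simp
qed

lemma generalized_mean_ideal_mean:
  assumes "set_ideal \<I>"
  shows "generalized_mean (ideal_mean_dom \<I>) (ideal_mean \<I>)"
  unfolding generalized_mean_def
  using Inf_le_ideal_mean[OF assms] ideal_mean_le_Sup[OF assms] ideal_mean_dom_nonempty[OF assms]
  by (auto simp: ideal_mean_dom_def)

text \<open>The lower limit of \<open>A\<close> is at most \<open>Sup A\<close>, hence at most
  \<open>Inf B\<close>, so adding \<open>B\<close> does not lower it, while the upper limit can only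
  rise. Dually, adding \<open>A\<close> to \<open>B\<close> does not raise the upper limit.\<close>

lemma monotone_mean_ideal_mean:
  assumes ideal: "set_ideal \<I>"
  shows "monotone_mean (ideal_mean_dom \<I>) (ideal_mean \<I>)"
  unfolding monotone_mean_def
proof (intro ballI impI, elim conjE)
  fix A B
  assume A: "A \<in> ideal_mean_dom \<I>" and B: "B \<in> ideal_mean_dom \<I>"
    and AB: "A \<union> B \<in> ideal_mean_dom \<I>" and le: "Sup A \<le> Inf B"
  have "min (Inf B) (ideal_liminf \<I> A) \<le> ideal_liminf \<I> (A \<union> B)"
    using cInf_lower ideal_mean_dom_bounds(1)[OF B] by (intro ideal_liminf_Un_ge[OF ideal A AB])
  moreover have "ideal_liminf \<I> A \<le> Inf B"
    using ideal_liminf_le_limsup[OF ideal A] ideal_limsup_le_Sup[OF ideal A] le by linarith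
  ultimately have 1: "ideal_liminf \<I> A \<le> ideal_liminf \<I> (A \<union> B)" by simp
  have BA: "B \<union> A \<in> ideal_mean_dom \<I>" using AB by (simp add: Un_commute)
  have "ideal_limsup \<I> (B \<union> A) \<le> max (Sup A) (ideal_limsup \<I> B)"
    using cSup_upper ideal_mean_dom_bounds(2)[OF A] by (intro ideal_limsup_Un_le[OF ideal B BA])
  moreover have "Sup A \<le> ideal_limsup \<I> B"
    using ideal_liminf_le_limsup[OF ideal B] Inf_le_ideal_liminf[OF ideal B] le by linarith
  ultimately have 2: "ideal_limsup \<I> (A \<union> B) \<le> ideal_limsup \<I> B" by (simp add: Un_commute)
  show "ideal_mean \<I> A \<le> ideal_mean \<I> (A \<union> B) \<and> ideal_mean \<I> (A \<union> B) \<le> ideal_mean \<I> B"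
    using 1 2 ideal_lim_subset[OF ideal A AB] ideal_lim_subset[OF ideal B AB]
    by (simp add: ideal_mean_def)
qed

text \<open>Adding \<open>L\<close> can lower the mean only by lowering the lower limit, and then the new lower limit
  (hence the new mean) is still at least \<open>Inf L\<close>; dually for the upper limit.\<close>

lemma convex_mean_ideal_mean:
  assumes ideal: "set_ideal \<I>"
  shows "convex_mean (ideal_mean_dom \<I>) (ideal_mean \<I>)"
  unfolding convex_mean_def
proof (intro allI impI, elim conjE)
  fix J H L
  assume J: "is_interval J" "closed J" and K: "ideal_mean \<I> H \<in> J" and L: "L \<subseteq> J"
    and H: "H \<in> ideal_mean_dom \<I>" and HL: "H \<union> L \<in> ideal_mean_dom \<I>"
  show "ideal_mean \<I> (H \<union> L) \<in> J"
  proof (cases "L = {}")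
    case False
    have bdd: "bdd_below L" "bdd_above L"
      using ideal_mean_dom_bounds[OF HL] by simp_all
    have "closure L \<subseteq> J" using L J(2) by (rule closure_minimal)
    \<comment> \<open>This is where closedness of \<open>J\<close> enters; \<open>L\<close> must be
      nonempty for its infimum and supremum to be meaningful.\<close>
    then have ends: "Inf L \<in> J" "Sup L \<in> J"
      using closure_contains_Inf[OF False bdd(1)] closure_contains_Sup[OF False bdd(2)] by auto
    have inf: "min (Inf L) (ideal_liminf \<I> H) \<le> ideal_liminf \<I> (H \<union> L)"
      using cInf_lower bdd(1) by (intro ideal_liminf_Un_ge[OF ideal H HL])
    have sup: "ideal_limsup \<I> (H \<union> L) \<le> max (Sup L) (ideal_limsup \<I> H)"
      using cSup_upper bdd(2) by (intro ideal_limsup_Un_le[OF ideal H HL])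
    have sub: "ideal_liminf \<I> (H \<union> L) \<le> ideal_liminf \<I> H"
      "ideal_limsup \<I> H \<le> ideal_limsup \<I> (H \<union> L)"
      using ideal_lim_subset[OF ideal H HL] by auto
    note between = ideal_mean_between[OF ideal HL]
    show ?thesis
    proof (cases "ideal_mean \<I> (H \<union> L)" "ideal_mean \<I> H" rule: linorder_cases)
      case less
      then have "ideal_liminf \<I> (H \<union> L) < ideal_liminf \<I> H"
        using sub by (simp add: ideal_mean_def)
      \<comment> \<open>The new lower limit is strictly below the old one, so the minimum in
        \<open>inf\<close> must be \<open>Inf L\<close>. The new mean is then trapped between two
        points of \<open>J\<close>.\<close>
      then have "Inf L \<le> ideal_mean \<I> (H \<union> L)" using inf between by linarith
      then show ?thesis using mem_is_interval_1_I[OF J(1) ends(1) K] less by simp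
    next
      case equal
      then show ?thesis using K by simp
    next
      case greater
      then have "ideal_limsup \<I> H < ideal_limsup \<I> (H \<union> L)"
        using sub by (simp add: ideal_mean_def)
      then have "ideal_mean \<I> (H \<union> L) \<le> Sup L" using sup between by linarith
      then show ?thesis using mem_is_interval_1_I[OF J(1) K ends(2)] greater by simp
    qed
  qed (use K in simp)
qed

section \<open>Affine invariance\<close>

lemma ideal_affine_image:
  assumes "shift_invariant_ideal \<I>" "homogeneous_ideal \<I>" "A \<in> \<I>"
  shows "(\<lambda>h. a * h + b) ` A \<in> \<I>"
proof -
  have "(\<lambda>h. h + b) ` (\<lambda>h. a * h) ` A \<in> \<I>"
    using assms by (simp add: shift_invariant_ideal_def homogeneous_ideal_def)
  then show ?thesis by (simp add: image_image)
qed

text \<open>The inverse of an affine map with nonzero slope is again affine, which supplies the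
  converse direction.\<close>

lemma ideal_affine_image_iff:
  assumes "shift_invariant_ideal \<I>" "homogeneous_ideal \<I>" "a \<noteq> 0"
  shows "(\<lambda>h. a * h + b) ` A \<in> \<I> \<longleftrightarrow> A \<in> \<I>"
proof
  assume "(\<lambda>h. a * h + b) ` A \<in> \<I>"
  then have "(\<lambda>h. inverse a * h + - b / a) ` (\<lambda>h. a * h + b) ` A \<in> \<I>"
    by (rule ideal_affine_image[OF assms(1,2)])
  moreover have "inverse a * (a * h + b) + - b / a = h" for h
    using \<open>a \<noteq> 0\<close> by (simp add: field_simps)
  ultimately show "A \<in> \<I>" by (simp only: image_image image_ident)
qed (rule ideal_affine_image[OF assms(1,2)])

lemma ideal_mean_affine:
  assumes ideal: "set_ideal \<I>" and inv: "shift_invariant_ideal \<I>" "homogeneous_ideal \<I>"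
    and H: "H \<in> ideal_mean_dom \<I>" and a: "a \<noteq> 0"
  shows "(\<lambda>h. a * h + b) ` H \<in> ideal_mean_dom \<I>"
    and "ideal_mean \<I> ((\<lambda>h. a * h + b) ` H) = a * ideal_mean \<I> H + b"
proof -
  let ?f = "\<lambda>h. a * h + b"
  note iff = ideal_affine_image_iff[OF inv a, of b]
  have "bounded ((\<lambda>h. b + h) ` (\<lambda>h. a * h) ` H)"
    using H bounded_scaling[of H a] by (intro bounded_translation) (simp add: ideal_mean_dom_def)
  then have "bounded (?f ` H)" by (simp add: image_image add.commute)
  then show "?f ` H \<in> ideal_mean_dom \<I>"
    using H iff by (simp add: ideal_mean_dom_def)
  let ?l = "ideal_liminf \<I> H" and ?u = "ideal_limsup \<I> H"
  \<comment> \<open>The cut property of each limit, in the shape that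
    \<open>ideal_liminf_eqI\<close> and \<open>ideal_limsup_eqI\<close> ask for after pulling back
    along \<open>?f\<close>.\<close>
  have low: "y < ?l \<Longrightarrow> H \<inter> {..y} \<in> \<I>" "?l < y \<Longrightarrow> H \<inter> {..y} \<notin> \<I>" for y
    using section_less_ideal_liminf[OF ideal H] section_le_ideal_liminf[OF ideal H] by (blast, meson leD)
  have up: "?u < y \<Longrightarrow> H \<inter> {y..} \<in> \<I>" "y < ?u \<Longrightarrow> H \<inter> {y..} \<notin> \<I>" for y
    using section_greater_ideal_limsup[OF ideal H] ideal_limsup_le_section[OF ideal H] by (blast, meson leD)
  show "ideal_mean \<I> (?f ` H) = a * ideal_mean \<I> H + b"
  proof (cases "0 < a")
    case True
    have "?f ` H \<inter> {..x} = ?f ` (H \<inter> {..(x - b) / a})"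
      and "?f ` H \<inter> {x..} = ?f ` (H \<inter> {(x - b) / a..})" for x
      using True by (auto simp: field_simps)
    note sec = this
    have "ideal_liminf \<I> (?f ` H) = a * ?l + b"
      by (rule ideal_liminf_eqI; simp only: sec iff; rule low)
        (use True in \<open>simp_all add: field_simps\<close>)
    moreover have "ideal_limsup \<I> (?f ` H) = a * ?u + b"
      by (rule ideal_limsup_eqI; simp only: sec iff; rule up)
        (use True in \<open>simp_all add: field_simps\<close>)
    ultimately show ?thesis by (simp add: ideal_mean_def field_simps)
  next
    case False
    then have a: "a < 0" using a by simp
    \<comment> \<open>A negative slope reverses order: lower sections pull back to upper ones, so
      \<open>?l\<close> and \<open>?u\<close> trade places.\<close>
    have "?f ` H \<inter> {..x} = ?f ` (H \<inter> {(x - b) / a..})"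
      and "?f ` H \<inter> {x..} = ?f ` (H \<inter> {..(x - b) / a})" for x
      using a by (auto simp: field_simps)
    note sec = this
    have "ideal_liminf \<I> (?f ` H) = a * ?u + b"
      by (rule ideal_liminf_eqI; simp only: sec iff; rule up)
        (use a in \<open>simp_all add: field_simps\<close>)
    moreover have "ideal_limsup \<I> (?f ` H) = a * ?l + b"
      by (rule ideal_limsup_eqI; simp only: sec iff; rule low)
        (use a in \<open>simp_all add: field_simps\<close>)
    ultimately show ?thesis by (simp add: ideal_mean_def field_simps)
  qed
qed

section \<open>Negligible changes and finite independence\<close>

text \<open>\<open>A\<close> and \<open>B\<close> differ only inside \<open>V\<close>, so each
  intersection with a fixed \<open>S\<close> is negligible for both or for neither; the limits
  depend on nothing else.\<close>

lemma ideal_mean_cong: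
  assumes ideal: "set_ideal \<I>" and V: "V \<in> \<I>" and AB: "A \<subseteq> B \<union> V" "B \<subseteq> A \<union> V"
  shows "A \<in> \<I> \<longleftrightarrow> B \<in> \<I>" "ideal_mean \<I> A = ideal_mean \<I> B"
proof -
  have iff: "A \<inter> S \<in> \<I> \<longleftrightarrow> B \<inter> S \<in> \<I>" for S
  proof
    assume "A \<inter> S \<in> \<I>"
    then have "A \<inter> S \<union> V \<in> \<I>" using V by (rule set_ideal_Un[OF ideal])
    then show "B \<inter> S \<in> \<I>" by (rule set_ideal_subset[OF ideal]) (use AB in blast)
  next
    assume "B \<inter> S \<in> \<I>"
    then have "B \<inter> S \<union> V \<in> \<I>" using V by (rule set_ideal_Un[OF ideal])
    then show "A \<inter> S \<in> \<I>" by (rule set_ideal_subset[OF ideal]) (use AB in blast)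
  qed
  show "A \<in> \<I> \<longleftrightarrow> B \<in> \<I>" using iff[of UNIV] by simp
  show "ideal_mean \<I> A = ideal_mean \<I> B"
    by (simp add: ideal_mean_def ideal_liminf_def ideal_limsup_def iff)
qed

lemma finite_independent_ideal_mean:
  assumes ideal: "set_ideal \<I>" and fin: "\<And>V. finite V \<Longrightarrow> V \<in> \<I>"
  shows "finite_independent (ideal_mean_dom \<I>) (ideal_mean \<I>)"
  unfolding finite_independent_def
proof (intro ballI allI impI, elim conjE)
  fix H V :: "real set"
  assume H: "H \<in> ideal_mean_dom \<I>" and "finite V"
  then have V: "V \<in> \<I>" "bounded V" by (simp_all add: fin finite_imp_bounded)
  note un = ideal_mean_cong[OF ideal V(1), of H "H \<union> V"]
    and diff = ideal_mean_cong[OF ideal V(1), of H "H - V"]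
  have "bounded (H \<union> V)" "bounded (H - V)"
    using H V(2) by (auto simp: ideal_mean_dom_def bounded_diff)
  then show "H \<union> V \<in> ideal_mean_dom \<I> \<and> H - V \<in> ideal_mean_dom \<I> \<and>
      ideal_mean \<I> H = ideal_mean \<I> (H \<union> V) \<and> ideal_mean \<I> H = ideal_mean \<I> (H - V)"
    using un diff H unfolding ideal_mean_dom_def by blast
qed

section \<open>Accumulation points and strong internality\<close>

lemma bounded_islimpt:
  fixes H :: "real set"
  assumes "bounded H"
  shows "bounded {x. x islimpt H}"
  by (rule bounded_subset[OF bounded_closure[OF assms]]) (auto simp: closure_def)

text \<open>Bolzano-Weierstrass: an infinite bounded section would have a limit point, which stays
  in the closed half-line \<open>{..x}\<close> and so lies below \<open>lower_acc H\<close>.\<close>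

lemma finite_section_less_lower_acc:
  assumes "bounded H" "x < lower_acc H"
  shows "finite (H \<inter> {..x})"
proof (rule ccontr)
  assume "infinite (H \<inter> {..x})"
  moreover have "bounded (H \<inter> {..x})" using assms(1) by (rule bounded_subset) simp
  ultimately obtain p where p: "p islimpt (H \<inter> {..x})"
    by (metis bounded_infinite_imp_islimpt subset_refl)
  then have "p \<le> x" and "p islimpt H"
    using islimpt_subset[OF p, of "{..x}"] islimpt_subset[OF p, of H] closed_limpt[of "{..x}"]
    by auto
  then have "lower_acc H \<le> p"
    unfolding lower_acc_def
    using bounded_imp_bdd_below[OF bounded_islimpt[OF assms(1)]] by (intro cInf_lower) auto
  with \<open>p \<le> x\<close> assms(2) show False by simp
qed

lemma finite_section_greater_upper_acc:
  assumes "bounded H" "upper_acc H < x"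
  shows "finite (H \<inter> {x..})"
proof (rule ccontr)
  assume "infinite (H \<inter> {x..})"
  moreover have "bounded (H \<inter> {x..})" using assms(1) by (rule bounded_subset) simp
  ultimately obtain p where p: "p islimpt (H \<inter> {x..})"
    by (metis bounded_infinite_imp_islimpt subset_refl)
  then have "x \<le> p" and "p islimpt H"
    using islimpt_subset[OF p, of "{x..}"] islimpt_subset[OF p, of H] closed_limpt[of "{x..}"]
    by auto
  then have "p \<le> upper_acc H"
    unfolding upper_acc_def
    using bounded_imp_bdd_above[OF bounded_islimpt[OF assms(1)]] by (intro cSup_upper) auto
  with \<open>x \<le> p\<close> assms(2) show False by simp
qed

lemma strongly_internal_ideal_mean:
  assumes ideal: "set_ideal \<I>" and fin: "\<And>V. finite V \<Longrightarrow> V \<in> \<I>"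
  shows "strongly_internal (ideal_mean_dom \<I>) (ideal_mean \<I>)"
  unfolding strongly_internal_def
proof (intro ballI impI)
  fix H assume H: "H \<in> ideal_mean_dom \<I>"
  then have "bounded H" by (simp add: ideal_mean_dom_def)
  have "lower_acc H \<le> ideal_liminf \<I> H"
    by (intro ideal_liminf_geI[OF ideal H] fin finite_section_less_lower_acc \<open>bounded H\<close>)
  moreover have "ideal_limsup \<I> H \<le> upper_acc H"
    by (intro ideal_limsup_leI[OF ideal H] fin finite_section_greater_upper_acc \<open>bounded H\<close>)
  ultimately show "lower_acc H \<le> ideal_mean \<I> H \<and> ideal_mean \<I> H \<le> upper_acc H"
    using ideal_mean_between[OF ideal H] by linarith
qed

section \<open>Assembly, with symmetry obtained from reflections\<close>

theorem theorem3p20: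
  fixes \<I> :: "real set set"
  assumes "set_ideal \<I>"
  shows "(generalized_mean (ideal_mean_dom \<I>) (ideal_mean \<I>) \<and>
          monotone_mean (ideal_mean_dom \<I>) (ideal_mean \<I>) \<and>
          convex_mean (ideal_mean_dom \<I>) (ideal_mean \<I>)) \<and>
         (shift_invariant_ideal \<I> \<and> symmetric_ideal \<I> \<and> homogeneous_ideal \<I> \<longrightarrow>
          shift_invariant_mean (ideal_mean_dom \<I>) (ideal_mean \<I>) \<and>
          symmetric_mean (ideal_mean_dom \<I>) (ideal_mean \<I>) \<and>
          homogeneous_mean (ideal_mean_dom \<I>) (ideal_mean \<I>)) \<and>
         ((\<forall>V. finite V \<longrightarrow> V \<in> \<I>) \<longrightarrow>
          finite_independent (ideal_mean_dom \<I>) (ideal_mean \<I>) \<and>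
          strongly_internal (ideal_mean_dom \<I>) (ideal_mean \<I>))"
proof -
  have "generalized_mean (ideal_mean_dom \<I>) (ideal_mean \<I>)"
    using generalized_mean_ideal_mean[OF assms] .
  moreover have "monotone_mean (ideal_mean_dom \<I>) (ideal_mean \<I>)"
    using monotone_mean_ideal_mean[OF assms] .
  moreover have "convex_mean (ideal_mean_dom \<I>) (ideal_mean \<I>)"
    using convex_mean_ideal_mean[OF assms] .
  moreover have "shift_invariant_mean (ideal_mean_dom \<I>) (ideal_mean \<I>) \<and>
      symmetric_mean (ideal_mean_dom \<I>) (ideal_mean \<I>) \<and>
      homogeneous_mean (ideal_mean_dom \<I>) (ideal_mean \<I>)"
    if "shift_invariant_ideal \<I>" "homogeneous_ideal \<I>"
    unfolding shift_invariant_mean_def symmetric_mean_def homogeneous_mean_def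
  proof (intro conjI ballI allI impI)
    \<comment> \<open>The single real \<open>x\<close> serves in turn as translation, scaling factor
      and centre of symmetry.\<close>
    fix H and x :: real
    assume H: "H \<in> ideal_mean_dom \<I>"
    note affine = ideal_mean_affine[OF assms that H]
    show "(\<lambda>h. h + x) ` H \<in> ideal_mean_dom \<I>"
      and "ideal_mean \<I> ((\<lambda>h. h + x) ` H) = ideal_mean \<I> H + x"
      using affine[of 1 x] by simp_all
    show "(\<lambda>h. x * h) ` H \<in> ideal_mean_dom \<I>"
      and "ideal_mean \<I> ((\<lambda>h. x * h) ` H) = x * ideal_mean \<I> H" if "x \<noteq> 0"
      using affine[OF that, of 0] by simp_all
    assume sym: "\<forall>y. x + y \<in> H \<longleftrightarrow> x - y \<in> H"
    have reflect: "2 * x - h \<in> H" if "h \<in> H" for h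
      using sym[rule_format, of "x - h"] that by simp
    \<comment> \<open>The reflection about \<open>x\<close> is an involution mapping
      \<open>H\<close> into itself, hence onto itself.\<close>
    have "(\<lambda>h. - 1 * h + 2 * x) ` H = H"
    proof (rule set_eqI, rule iffI)
      fix h assume "h \<in> H"
      then have "2 * x - h \<in> H" by (rule reflect)
      then show "h \<in> (\<lambda>h. - 1 * h + 2 * x) ` H"
        by (rule rev_image_eqI) simp
    qed (use reflect in auto)
    then show "ideal_mean \<I> H = x"
      using affine(2)[of "- 1" "2 * x"] by simp
  qed
  moreover have "finite_independent (ideal_mean_dom \<I>) (ideal_mean \<I>)"
    and "strongly_internal (ideal_mean_dom \<I>) (ideal_mean \<I>)"
    if "\<forall>V. finite V \<longrightarrow> V \<in> \<I>"
    using finite_independent_ideal_mean[OF assms] strongly_internal_ideal_mean[OF assms] that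
    by blast+
  ultimately show ?thesis by blast
qed

end
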